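(* Let $n$ be a positive integer and let $G = \mathrm{Kneser}(n,2)$. Then $$\mathrm{tw}(G) = \begin{cases} 0 & \text{if } n \leq 3,\\ 1 & \text{if } n = 4,\\ 4 & \text{if } n = 5,\\ \binom{n-1}{2} - 1 & \text{if } n \geq 6.\end{cases}$$
   Context: For positive integers $n,k$, the Kneser graph $\mathrm{Kneser}(n,k)$ has as vertex set the family of all $k$-element subsets of $[n]=\{1,\dots,n\}$, with two vertices adjacent if and only if they are disjoint sets. A tree decomposition of a graph $G$ is a pair $(T,(B_x)_{x\in V(T)})$ with $T$ a tree and $B_x\subseteq V(G)$, such that for each vertex $v$ the nodes $x$ with $v\in B_x$ induce a non-empty connected subtree of $T$, and each edge of $G$ has both ends in some bag $B_x$. Its width is $\max_x |B_x| - 1$, and the treewidth $\mathrm{tw}(G)$ is the minimum width of a tree decomposition of $G$. *)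

theory Defs
  imports "Graph_Theory.Graph_Theory"
begin

text \<open>
  Following \<^theory>\<open>Graph_Theory.Digraph\<close>, a finite simple graph is a finite, symmetric, loop-free
  relation on its vertices (\<^locale>\<open>pair_graph\<close>): every edge occurs as a pair of opposite arcs.
\<close>

text \<open>Loop-free, hence a simple graph, only for \<open>k > 0\<close>.\<close>

definition Kneser :: "nat \<Rightarrow> nat \<Rightarrow> nat set pair_pre_digraph" where
  "Kneser n k =
    \<lparr> pverts = {A. A \<subseteq> {1..n} \<and> card A = k},
      parcs = {(A, B). A \<subseteq> {1..n} \<and> card A = k \<and> B \<subseteq> {1..n} \<and> card B = k \<and> A \<inter> B = {}} \<rparr>"

text \<open>
  The library predicate \<^const>\<open>tree\<close> only forbids directed cycles. It therefore accepts acyclic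
  orientations of a triangle, and rejects every symmetric digraph with an edge, since traversing
  an edge back and forth is a directed cycle of length 2. In a symmetric loop-free digraph, the
  cycles of the underlying undirected graph are the directed cycles of length at least 3.
\<close>

definition undirected_tree :: "'a pair_pre_digraph \<Rightarrow> bool" where
  "undirected_tree T \<longleftrightarrow>
    pair_graph T \<and> Digraph_Component.connected (with_proj T) \<and>
    \<not> (\<exists>p. pre_digraph.cycle (with_proj T) p \<and> 3 \<le> length p)"

text \<open>Note that \<^const>\<open>Digraph_Component.connected\<close> entails that the vertex set is non-empty.\<close>

definition tree_decomposition ::
  "'v pair_pre_digraph \<Rightarrow> 'a pair_pre_digraph \<Rightarrow> ('a \<Rightarrow> 'v set) \<Rightarrow> bool" where
  "tree_decomposition G T B \<longleftrightarrow>
    pair_graph G \<and> undirected_tree T \<and>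
    (\<forall>x\<in>pverts T. B x \<subseteq> pverts G) \<and>
    (\<forall>v\<in>pverts G. Digraph_Component.connected (with_proj T \<restriction> {x \<in> pverts T. v \<in> B x})) \<and>
    (\<forall>(u, v)\<in>parcs G. \<exists>x\<in>pverts T. u \<in> B x \<and> v \<in> B x)"

text \<open>
  The subtraction is the truncated one on \<^typ>\<open>nat\<close>. This matters only for the graph without
  vertices, all of whose bags are empty: its width is 0 by convention.
\<close>

definition width :: "'a pair_pre_digraph \<Rightarrow> ('a \<Rightarrow> 'v set) \<Rightarrow> nat" where
  "width T B = Max ((\<lambda>x. card (B x)) ` pverts T) - 1"

text \<open>Trees are finite, so up to isomorphism their nodes may be taken to be natural numbers.\<close>

definition treewidth :: "'v pair_pre_digraph \<Rightarrow> nat" where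
  "treewidth G =
    (LEAST w. \<exists>(T :: nat pair_pre_digraph) B. tree_decomposition G T B \<and> width T B = w)"

lemma pair_graph_Kneser:
  assumes "k > 0"
  shows "pair_graph (Kneser n k)"
proof
  have V: "finite (pverts (Kneser n k))"
    by (rule finite_subset[of _ "Pow {1..n}"]) (auto simp: Kneser_def)
  then show "finite (pverts (Kneser n k))" .
  show "finite (parcs (Kneser n k))"
    by (rule finite_subset[OF _ finite_cartesian_product[OF V V]]) (auto simp: Kneser_def)
  show "symmetric (with_proj (Kneser n k))"
    by (auto simp: symmetric_def Kneser_def intro: symI)
next
  fix e
  assume "e \<in> parcs (Kneser n k)"
  then obtain A B where e: "e = (A, B)" "A \<subseteq> {1..n}" "card A = k" "B \<subseteq> {1..n}" "card B = k"
      "A \<inter> B = {}"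
    by (cases e) (simp add: Kneser_def)
  show "fst e \<in> pverts (Kneser n k)" "snd e \<in> pverts (Kneser n k)"
    using e by (simp_all add: Kneser_def)
  from e have "A \<noteq> {}"
    using assms by (metis card.empty less_irrefl)
  with e show "fst e \<noteq> snd e"
    by (metis Int_absorb fst_conv snd_conv)
qed

text \<open>The set over which \<^const>\<open>treewidth\<close> minimises is non-empty, so the minimum is attained.\<close>

lemma tree_decomposition_single_bag:
  assumes "pair_graph G"
  shows "tree_decomposition G \<lparr> pverts = {0 :: nat}, parcs = {} \<rparr> (\<lambda>_. pverts G)"
proof -
  let ?T = "\<lparr> pverts = {0 :: nat}, parcs = {} \<rparr>"
  have T: "pair_graph ?T"
    by unfold_locales (auto simp: symmetric_def intro: symI)
  interpret T: pair_graph ?T by (fact T)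
  interpret G: pair_graph G by (fact assms)
  have conn: "Digraph_Component.connected H" if "verts H = {0 :: nat}" for H :: "(nat, nat \<times> nat) pre_digraph"
    using that
    by (auto simp: Digraph_Component.connected_def strongly_connected_def mk_symmetric_def
        reachable_def)
  have "\<not> pre_digraph.cycle (with_proj ?T) p" for p
    by (cases p) (auto simp: T.cycle_def T.awalk_def)
  then have "undirected_tree ?T"
    by (auto simp: undirected_tree_def intro: conn)
  then show ?thesis
    using assms by (auto simp: tree_decomposition_def intro!: conn dest: G.in_arcsD1 G.in_arcsD2)
qed

lemma treewidth_attained:
  assumes "pair_graph G"
  obtains T :: "nat pair_pre_digraph" and B
  where "tree_decomposition G T B" "width T B = treewidth G"
proof -
  have "\<exists>w (T :: nat pair_pre_digraph) B. tree_decomposition G T B \<and> width T B = w"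
    using tree_decomposition_single_bag[OF assms] by blast
  from LeastI_ex[OF this] show ?thesis
    using that unfolding treewidth_def by blast
qed

end

theory Submission
  imports Defs
begin

text \<open>
  Subtrees of a tree have the Helly property, so some bag of any tree decomposition meets all members
  of a bramble (a family of connected, pairwise touching vertex sets). Regard the vertices of
  \<open>Kneser n 2\<close> as edges of \<open>K\<^sub>n\<close>. If all bags have at most \<open>(n choose 2) - max 6 n\<close> elements, then
  the complement of each bag is too large to be pairwise intersecting, hence it contains two disjoint
  edges. The components of these in the complements of the bags form a bramble: two of them that do
  not touch would force both complements to be the same \<open>K\<^sub>4\<close>. But no bag meets the component
  chosen for its own complement.

  For \<open>n \<noteq> 4, 5\<close> the matching decomposition is a star: the central bag omits an independent set (the
  edges at one vertex of \<open>K\<^sub>n\<close>), and each omitted vertex has a leaf with its closed neighbourhood.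
\<close>

section \<open>Connected sets and trees\<close>

text \<open>Paths in \<open>rtrancl_on S E\<close> stay inside \<open>S\<close>, so this is
  connectedness of the subgraph induced by \<open>S\<close>.\<close>

definition connected_on :: "'a rel \<Rightarrow> 'a set \<Rightarrow> bool" where
  "connected_on E S \<longleftrightarrow> S \<noteq> {} \<and> (\<forall>u\<in>S. \<forall>v\<in>S. (u, v) \<in> rtrancl_on S E)"

text \<open>Prepending the last vertex makes \<open>successively\<close> test the closing edge as
  well. Length at least 3 rules out an edge walked back and forth.\<close>

definition cycle_free :: "'a rel \<Rightarrow> bool" where
  "cycle_free E \<longleftrightarrow>
    \<not> (\<exists>vs. 3 \<le> length vs \<and> distinct vs \<and> successively (\<lambda>x y. (x, y) \<in> E) (last vs # vs))"

lemma rtrancl_on_Int: "rtrancl_on S (E \<inter> S \<times> S) = rtrancl_on S E"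
proof (rule set_eqI)
  fix p :: "'a \<times> 'a"
  have "(a, b) \<in> rtrancl_on S (E \<inter> S \<times> S)" if "(a, b) \<in> rtrancl_on S E" for a b
    using that by (induction rule: rtrancl_on_induct) (auto intro: rtrancl_on_into_rtrancl_on)
  then show "p \<in> rtrancl_on S (E \<inter> S \<times> S) \<longleftrightarrow> p \<in> rtrancl_on S E"
    by (cases p) (auto intro: rtrancl_on_mono[of "E \<inter> S \<times> S" E S S])
qed

lemma connected_onI_root:
  assumes "sym E" "r \<in> S" "\<And>v. v \<in> S \<Longrightarrow> (r, v) \<in> rtrancl_on S E"
  shows "connected_on E S"
  unfolding connected_on_def
  using assms rtrancl_on_sym[OF assms(1), of S] by (blast intro: rtrancl_on_trans dest: symD)

text \<open>The library symmetrises the arcs before testing reachability, which changes nothing for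
  a symmetric relation.\<close>

lemma connected_induce_subgraph_iff:
  assumes "pair_graph T"
  shows "Digraph_Component.connected (with_proj T \<restriction> S) \<longleftrightarrow> connected_on (parcs T) S"
proof -
  interpret pair_graph T by fact
  have "sym (parcs T)"
    using sym_arcs by (simp add: symmetric_def)
  then have "parcs (mk_symmetric (with_proj T \<restriction> S)) = parcs T \<inter> S \<times> S"
    by (auto simp: parcs_mk_symmetric dest: symD)
  then show ?thesis
    by (simp add: Digraph_Component.connected_def strongly_connected_def reachable_def
        connected_on_def rtrancl_on_Int)
qed

lemma connected_pair_graph_iff:
  assumes "pair_graph T"
  shows "Digraph_Component.connected (with_proj T) \<longleftrightarrow> connected_on (parcs T) (pverts T)"
proof -
  interpret pair_graph T by fact
  have "with_proj T \<restriction> pverts T = with_proj T"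
    by (auto simp: induce_subgraph_def with_proj_def dest: in_arcsD1 in_arcsD2)
  then show ?thesis
    using connected_induce_subgraph_iff[OF assms, of "pverts T"] by simp
qed

section \<open>Arc cycles as cyclic vertex lists\<close>

lemma pcas_vwalk_arcs: "pcas u (vwalk_arcs (u # vs)) (last (u # vs))"
  by (induction vs arbitrary: u) auto

lemma map_snd_vwalk_arcs: "map snd (vwalk_arcs (u # vs)) = vs"
  by (induction vs arbitrary: u) auto

lemma set_vwalk_arcs_subset_iff:
  "set (vwalk_arcs (u # vs)) \<subseteq> E \<longleftrightarrow> successively (\<lambda>x y. (x, y) \<in> E) (u # vs)"
  by (induction vs arbitrary: u) auto

lemma pcas_eq_vwalk_arcs: "pcas u p v \<Longrightarrow> p = vwalk_arcs (u # map snd p) \<and> last (u # map snd p) = v"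
  by (induction p arbitrary: u) (auto simp: prod_eq_iff)

text \<open>A closed arc walk \<open>p\<close> from \<open>u\<close> visits
  \<open>u # map snd p\<close> and ends in \<open>u\<close>. So \<open>map snd p\<close> is the
  matching cyclic list, and it is the part of the walk that \<open>cycle\<close> requires to be
  distinct.\<close>

lemma cycle_free_iff:
  assumes "pair_graph T"
  shows "cycle_free (parcs T) \<longleftrightarrow> \<not> (\<exists>p. pre_digraph.cycle (with_proj T) p \<and> 3 \<le> length p)"
proof -
  interpret pair_graph T by fact
  have tl_verts: "tl (awalk_verts u p) = map snd p" if "cas u p v" "p \<noteq> []" for u p v
    using awalk_verts_conv'[OF that(1)] that(2) by simp
  have "\<exists>p. cycle p \<and> 3 \<le> length p"
    if vs: "3 \<le> length vs" "distinct vs" "successively (\<lambda>x y. (x, y) \<in> parcs T) (last vs # vs)" for vs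
  proof -
    let ?u = "last vs" and ?p = "vwalk_arcs (last vs # vs)"
    have len: "length ?p = length vs"
      by (metis map_snd_vwalk_arcs length_map)
    have ne: "vs \<noteq> []" "?p \<noteq> []"
      using vs(1) len by auto
    have cas: "cas ?u ?p ?u"
      using pcas_vwalk_arcs[of ?u vs] ne by simp
    have arcs: "set ?p \<subseteq> parcs T"
      using vs(3) by (simp only: set_vwalk_arcs_subset_iff)
    have "?u \<in> pverts T"
      using ne vs(3) by (cases vs) (auto dest: in_arcsD1)
    then have "cycle ?p"
      unfolding cycle_def awalk_def using cas arcs ne tl_verts[OF cas] map_snd_vwalk_arcs[of ?u vs] vs(2)
      by auto
    then show ?thesis
      using len vs(1) by auto
  qed
  moreover have "\<exists>vs. 3 \<le> length vs \<and> distinct vs \<and> successively (\<lambda>x y. (x, y) \<in> parcs T) (last vs # vs)"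
    if "cycle p" "3 \<le> length p" for p
  proof -
    from that obtain u where u: "awalk u p u" "distinct (tl (awalk_verts u p))" "p \<noteq> []"
      by (auto simp: cycle_def)
    then have cas: "cas u p u" and arcs: "set p \<subseteq> parcs T"
      by (auto simp: awalk_def)
    have p: "p = vwalk_arcs (u # map snd p)" "last (u # map snd p) = u"
      using pcas_eq_vwalk_arcs[of u p u] cas by auto
    then have "successively (\<lambda>x y. (x, y) \<in> parcs T) (u # map snd p)"
      using arcs by (metis set_vwalk_arcs_subset_iff)
    moreover have "last (map snd p) = u"
      using p(2) u(3) by simp
    ultimately show ?thesis
      using u that(2) tl_verts[OF cas u(3)] by (intro exI[of _ "map snd p"]) auto
  qed
  ultimately show ?thesis
    unfolding cycle_free_def by blast
qed

section \<open>The Helly property and brambles\<close>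

lemma connected_on_neighbour:
  assumes "connected_on E S" "l \<in> S" "S \<noteq> {l}"
  obtains y where "y \<in> S" "y \<noteq> l" "(l, y) \<in> E"
proof -
  obtain c where c: "c \<in> S" "c \<noteq> l"
    using assms by auto
  then have "(l, c) \<in> rtrancl_on S E"
    using assms by (auto simp: connected_on_def)
  \<comment> \<open>Loops are possible here: backward induction along the path skips them, and the
    first step that is not a loop gives the neighbour.\<close>
  then have "c \<noteq> l \<longrightarrow> (\<exists>y\<in>S. y \<noteq> l \<and> (l, y) \<in> E)"
    by (induction rule: converse_rtrancl_on_induct) metis+
  then show thesis
    using c(2) that by blast
qed

text \<open>The first vertex of a longest path is a leaf: by maximality its neighbours lie on the
  path, and one beyond the second vertex would close a cycle. The alternative \<open>y = l\<close>
  allows for loops, which \<open>cycle_free\<close> permits.\<close>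

lemma cycle_free_leaf:
  assumes "finite V" "connected_on E V" "sym E" "cycle_free E" "a \<in> V" "b \<in> V" "a \<noteq> b"
  obtains l m where "l \<in> V" "m \<in> V" "l \<noteq> m" "(l, m) \<in> E" "\<And>y. y \<in> V \<Longrightarrow> (l, y) \<in> E \<Longrightarrow> y = m \<or> y = l"
proof -
  define P where "P p \<longleftrightarrow> p \<noteq> [] \<and> distinct p \<and> set p \<subseteq> V \<and> successively (\<lambda>x y. (x, y) \<in> E) p" for p
  have "P [a]"
    using assms by (simp add: P_def)
  moreover have "length p \<le> card V" if "P p" for p
    using that assms(1) by (metis P_def card_mono distinct_card)
  ultimately obtain p where p: "P p" "\<And>q. P q \<Longrightarrow> length q \<le> length p"
    using ex_has_greatest_nat[of P "[a]" length "Suc (card V)"] by (auto simp: less_Suc_eq_le)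
  from p(1) obtain l q where lq: "p = l # q"
    by (cases p) (auto simp: P_def)
  have l: "l \<in> V"
    using p(1) lq by (auto simp: P_def)
  obtain m' where m': "m' \<in> V" "m' \<noteq> l" "(l, m') \<in> E"
    using connected_on_neighbour[OF assms(2) l] assms(5-7) by blast
  have in_q: "y \<in> set q" if "y \<in> V" "(l, y) \<in> E" "y \<noteq> l" for y
  proof (rule ccontr)
    assume "y \<notin> set q"
    then have "P (y # p)"
      using that p(1) lq symD[OF assms(3)] by (auto simp: P_def)
    then show False
      using p(2) by fastforce
  qed
  from in_q[OF m'(1,3,2)] obtain m q' where q: "q = m # q'"
    by (cases q) auto
  have "y = m \<or> y = l" if y: "y \<in> V" "(l, y) \<in> E" for y
  proof (rule ccontr)
    assume ne: "\<not> (y = m \<or> y = l)"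
    then have "y \<in> set q'"
      using in_q[OF y] q by auto
    then obtain xs ys where "q' = xs @ y # ys"
      by (meson split_list)
    then have p_eq: "p = (l # m # xs @ [y]) @ ys"
      using lq q by simp
    then have "distinct (l # m # xs @ [y])" "successively (\<lambda>x y. (x, y) \<in> E) (l # m # xs @ [y])"
      using p(1)[unfolded P_def p_eq successively_append_iff distinct_append] by blast+
    moreover from this have "successively (\<lambda>x y. (x, y) \<in> E) (last (l # m # xs @ [y]) # l # m # xs @ [y])"
      using symD[OF assms(3) y(2)] by simp
    moreover have "3 \<le> length (l # m # xs @ [y])"
      by simp
    ultimately show False
      using assms(4) unfolding cycle_free_def by blast
  qed
  then show thesis
    using that[of l m] l p(1) lq q by (auto simp: P_def)
qed

text \<open>A path through \<open>l\<close> enters and leaves it by \<open>m\<close>, so the detour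
  can be cut out.\<close>

lemma connected_on_remove_leaf:
  assumes "connected_on E S" "sym E" "S \<noteq> {l}"
    and leaf: "\<And>y. y \<in> S \<Longrightarrow> (l, y) \<in> E \<Longrightarrow> y = m \<or> y = l"
  shows "connected_on E (S - {l})"
  unfolding connected_on_def
proof (intro conjI ballI)
  show "S - {l} \<noteq> {}"
    using assms by (auto simp: connected_on_def)
  fix u v assume u: "u \<in> S - {l}" and v: "v \<in> S - {l}"
  have "(u, v) \<in> rtrancl_on S E"
    using assms u v by (auto simp: connected_on_def)
  \<comment> \<open>While the path sits at \<open>l\<close>, the invariant remembers that
    \<open>m\<close> was reached without \<open>l\<close>.\<close>
  then have "if v = l then (u, m) \<in> rtrancl_on (S - {l}) E else (u, v) \<in> rtrancl_on (S - {l}) E"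
  proof (induction rule: rtrancl_on_induct)
    case base
    then show ?case using u by auto
  next
    case (step y z)
    have "y = m" if "z = l" "y \<noteq> l"
      using leaf[of y] symD[OF assms(2) step(2)] step(3) that by auto
    moreover have "z = m" if "y = l" "z \<noteq> l"
      using leaf[of z] step that by auto
    ultimately show ?case
      using step by (auto split: if_splits intro: rtrancl_on_into_rtrancl_on dest: in_rtrancl_on_in_F)
  qed
  then show "(u, v) \<in> rtrancl_on (S - {l}) E"
    using v by auto
qed

lemma connected_on_leaf_neighbour:
  assumes "connected_on E S" "l \<in> S" "S \<noteq> {l}"
    and leaf: "\<And>y. y \<in> S \<Longrightarrow> (l, y) \<in> E \<Longrightarrow> y = m \<or> y = l"
  shows "m \<in> S"
  using connected_on_neighbour[OF assms(1-3)] leaf by blast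

text \<open>Induction on the number of nodes, deleting a leaf \<open>l\<close> with neighbour
  \<open>m\<close> from the tree and from every member. If \<open>{l}\<close> is a member, all
  members contain \<open>l\<close>. Otherwise each member containing \<open>l\<close> also contains
  \<open>m\<close>, so intersections stay non-empty.\<close>

lemma helly_subtrees:
  assumes "finite V" "connected_on E V" "sym E" "cycle_free E"
    and "\<And>S. S \<in> F \<Longrightarrow> S \<subseteq> V \<and> connected_on E S"
    and "\<And>S S'. S \<in> F \<Longrightarrow> S' \<in> F \<Longrightarrow> S \<inter> S' \<noteq> {}"
  shows "\<exists>x\<in>V. \<forall>S\<in>F. x \<in> S"
  using assms(1,2,5,6)
proof (induction "card V" arbitrary: V F rule: less_induct)
  case less
  show ?case
  proof (cases "\<exists>a\<in>V. \<exists>b\<in>V. a \<noteq> b")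
    case False
    then obtain x where "V = {x}"
      using less.prems(2) by (auto simp: connected_on_def)
    then show ?thesis
      using less.prems(3) by (auto simp: connected_on_def)
  next
    case True
    then obtain l m where lm: "l \<in> V" "m \<in> V" "l \<noteq> m"
      and leaf: "\<And>y. y \<in> V \<Longrightarrow> (l, y) \<in> E \<Longrightarrow> y = m \<or> y = l"
      using cycle_free_leaf[OF less.prems(1,2) assms(3,4)] by metis
    show ?thesis
    proof (cases "{l} \<in> F")
      case True
      then show ?thesis
        using less.prems(4) lm(1) by blast
    next
      case False
      let ?F = "(\<lambda>S. S - {l}) ` F"
      have "\<exists>x\<in>V - {l}. \<forall>S\<in>?F. x \<in> S"
      proof (rule less.hyps)
        show "card (V - {l}) < card V"
          using less.prems(1) lm(1) by (rule card_Diff1_less)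
        show "connected_on E (V - {l})"
          using lm leaf by (intro connected_on_remove_leaf[OF less.prems(2) assms(3)]) auto
        show "S \<subseteq> V - {l} \<and> connected_on E S" if S: "S \<in> ?F" for S
        proof -
          obtain R where R: "R \<in> F" "S = R - {l}"
            using S by auto
          then show ?thesis
            using less.prems(3)[OF R(1)] False leaf
            by (auto intro!: connected_on_remove_leaf[OF _ assms(3), of _ _ m])
        qed
        show "S \<inter> S' \<noteq> {}" if S: "S \<in> ?F" "S' \<in> ?F" for S S'
        proof -
          obtain R R' where R: "R \<in> F" "S = R - {l}" "R' \<in> F" "S' = R' - {l}"
            using S by auto
          have "m \<in> Q" if Q: "Q \<in> F" "l \<in> Q" for Q
          proof (rule connected_on_leaf_neighbour)
            show "connected_on E Q" "l \<in> Q" "Q \<noteq> {l}"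
              using less.prems(3)[OF Q(1)] Q False by blast+
            show "y = m \<or> y = l" if "y \<in> Q" "(l, y) \<in> E" for y
              using less.prems(3)[OF Q(1)] leaf that by blast
          qed
          then show ?thesis
            using less.prems(4)[OF R(1,3)] R lm(3) by blast
        qed
      qed (use less.prems(1) in auto)
      then show ?thesis
        by auto
    qed
  qed
qed

text \<open>The nodes whose bags meet a connected set \<open>S\<close> form a subtree
  \<open>M S\<close>, and touching sets have intersecting subtrees. The Helly property gives a
  common node.\<close>

lemma bramble_hit_by_bag:
  assumes "tree_decomposition G T B"
    and F: "\<And>S. S \<in> F \<Longrightarrow> S \<subseteq> pverts G \<and> connected_on (parcs G) S"
    and touch: "\<And>S S'. S \<in> F \<Longrightarrow> S' \<in> F \<Longrightarrow> S \<inter> S' \<noteq> {} \<or> (\<exists>u\<in>S. \<exists>v\<in>S'. (u, v) \<in> parcs G)"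
  shows "\<exists>x\<in>pverts T. \<forall>S\<in>F. B x \<inter> S \<noteq> {}"
proof -
  have T: "pair_graph T" "connected_on (parcs T) (pverts T)" "cycle_free (parcs T)"
    using assms(1) connected_pair_graph_iff[of T] cycle_free_iff[of T]
    by (auto simp: tree_decomposition_def undirected_tree_def)
  interpret T: pair_graph T by fact
  have symT: "sym (parcs T)"
    using T.sym_arcs by (simp add: symmetric_def)
  define N where "N v = {x \<in> pverts T. v \<in> B x}" for v
  define M where "M S = {x \<in> pverts T. B x \<inter> S \<noteq> {}}" for S
  have N: "connected_on (parcs T) (N v)" if "v \<in> pverts G" for v
    using assms(1) that connected_induce_subgraph_iff[OF T(1)]
    by (auto simp: tree_decomposition_def N_def)
  have edge: "N u \<inter> N v \<noteq> {}" if "(u, v) \<in> parcs G" for u v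
    using assms(1) that by (auto simp: tree_decomposition_def N_def)
  have "connected_on (parcs T) (M S)" if "S \<in> F" for S
  proof -
    have NM: "N v \<subseteq> M S" if "v \<in> S" for v
      using that by (auto simp: N_def M_def)
    have step: "(x, y) \<in> rtrancl_on (M S) (parcs T)" if "x \<in> N v" "y \<in> N v" "v \<in> S" for x y v
    proof (rule rtrancl_on_mono[OF subset_refl NM[OF that(3)]])
      show "(x, y) \<in> rtrancl_on (N v) (parcs T)"
        using that N[of v] F[OF \<open>S \<in> F\<close>] by (auto simp: connected_on_def)
    qed
    note bag_step = step
    \<comment> \<open>Along a path in \<open>S\<close>, the subtrees of consecutive vertices share a
      node, since some bag contains their edge.\<close>
    have reach: "\<forall>x\<in>N v. \<forall>y\<in>N w. (x, y) \<in> rtrancl_on (M S) (parcs T)"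
      if "(v, w) \<in> rtrancl_on S (parcs G)" for v w
      using that
    proof (induction rule: rtrancl_on_induct)
      case base
      then show ?case using step by blast
    next
      case (step w w')
      from edge[OF step(2)] obtain z where "z \<in> N w" "z \<in> N w'"
        by blast
      then show ?case
        using step bag_step by (blast intro: rtrancl_on_trans)
    qed
    obtain v where "v \<in> S"
      using F[OF \<open>S \<in> F\<close>] by (auto simp: connected_on_def)
    then have "M S \<noteq> {}"
      using N[of v] NM[of v] F[OF that] by (auto simp: connected_on_def)
    moreover have "(x, y) \<in> rtrancl_on (M S) (parcs T)" if xy: "x \<in> M S" "y \<in> M S" for x y
    proof -
      obtain v w where "v \<in> S" "w \<in> S" "x \<in> N v" "y \<in> N w"
        using xy by (auto simp: M_def N_def)
      then show ?thesis
        using reach[of v w] F[OF \<open>S \<in> F\<close>] by (simp add: connected_on_def)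
    qed
    ultimately show ?thesis
      by (simp add: connected_on_def)
  qed
  moreover have "M S \<inter> M S' \<noteq> {}" if "S \<in> F" "S' \<in> F" for S S'
    using touch[OF that]
  proof
    assume "S \<inter> S' \<noteq> {}"
    then obtain v where v: "v \<in> S" "v \<in> S'"
      by blast
    then have "N v \<noteq> {}"
      using N[of v] F[OF that(1)] by (auto simp: connected_on_def)
    then show ?thesis
      using v by (auto simp: M_def N_def)
  next
    assume "\<exists>u\<in>S. \<exists>v\<in>S'. (u, v) \<in> parcs G"
    then show ?thesis
      using edge by (fastforce simp: M_def N_def)
  qed
  ultimately have "\<exists>x\<in>pverts T. \<forall>R\<in>M ` F. x \<in> R"
    by (intro helly_subtrees[OF T.pair_finite_verts T(2) symT T(3)]) (auto simp: M_def)
  then show ?thesis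
    by (auto simp: M_def)
qed

section \<open>Trees given by a parent function\<close>

text \<open>The root is \<open>0\<close>; the guards \<open>0 < i\<close> and \<open>0 < j\<close>
  keep \<open>par 0\<close> from adding an arc there. The facts below assume that parents are
  smaller, which permits induction on the node.\<close>

definition parent_tree :: "nat \<Rightarrow> (nat \<Rightarrow> nat) \<Rightarrow> nat pair_pre_digraph" where
  "parent_tree k par = \<lparr> pverts = {..<k},
    parcs = {(i, j). i < k \<and> j < k \<and> (0 < i \<and> j = par i \<or> 0 < j \<and> i = par j)} \<rparr>"

lemma sym_parent_tree: "sym (parcs (parent_tree k par))"
  by (auto simp: parent_tree_def intro: symI)

lemma pair_graph_parent_tree:
  assumes "\<And>i. 0 < i \<Longrightarrow> i < k \<Longrightarrow> par i < i"
  shows "pair_graph (parent_tree k par)"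
proof
  show "finite (pverts (parent_tree k par))"
    by (simp add: parent_tree_def)
  show "finite (parcs (parent_tree k par))"
    by (rule finite_subset[of _ "{..<k} \<times> {..<k}"]) (auto simp: parent_tree_def)
  show "symmetric (with_proj (parent_tree k par))"
    by (simp add: symmetric_def sym_parent_tree)
  show "fst e \<noteq> snd e" if "e \<in> parcs (parent_tree k par)" for e
  proof -
    have "par i \<noteq> i \<and> i \<noteq> par i" if "0 < i" "i < k" for i
      using assms[OF that] by simp
    then show ?thesis
      using that by (cases e) (auto simp: parent_tree_def)
  qed
qed (auto simp: parent_tree_def)

text \<open>Climbing to parents stays in \<open>X\<close> until it stops, and it can stop only at
  \<open>r\<close>, the top node of \<open>X\<close>.\<close>

lemma connected_on_parent_tree:
  assumes par: "\<And>i. 0 < i \<Longrightarrow> i < k \<Longrightarrow> par i < i"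
    and "X \<subseteq> {..<k}" "r \<in> X" "\<And>i. i \<in> X \<Longrightarrow> i = r \<or> 0 < i \<and> par i \<in> X"
  shows "connected_on (parcs (parent_tree k par)) X"
proof (rule connected_onI_root[OF sym_parent_tree assms(3)])
  fix v assume "v \<in> X"
  then show "(r, v) \<in> rtrancl_on X (parcs (parent_tree k par))"
  proof (induction v rule: less_induct)
    case (less v)
    show ?case
    proof (cases "v = r")
      case False
      then have v: "0 < v" "par v \<in> X" "v < k" "par v < k"
        using assms less.prems by auto
      then have "(r, par v) \<in> rtrancl_on X (parcs (parent_tree k par))"
        using less par by blast
      then show ?thesis
        by (rule rtrancl_on_into_rtrancl_on) (use v less.prems in \<open>auto simp: parent_tree_def\<close>)
    qed (use assms in auto)
  qed
qed

text \<open>On a cycle, both neighbours of the largest vertex would be its parent.\<close>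

lemma cycle_free_parent_tree:
  assumes par: "\<And>i. 0 < i \<Longrightarrow> i < k \<Longrightarrow> par i < i"
  shows "cycle_free (parcs (parent_tree k par))"
  unfolding cycle_free_def
proof (rule notI, elim exE conjE)
  let ?E = "parcs (parent_tree k par)"
  fix vs
  assume vs: "3 \<le> length vs" "distinct vs" "successively (\<lambda>x y. (x, y) \<in> ?E) (last vs # vs)"
  have "vs \<noteq> []"
    using vs(1) by auto
  then obtain xs ys where split: "vs = xs @ Max (set vs) # ys"
    by (metis List.finite_set Max_in set_empty split_list)
  define m where "m = Max (set vs)"
  \<comment> \<open>The rest of the cycle, read from the vertex after \<open>m\<close> round to the
    one before it; its two ends are the neighbours of \<open>m\<close>.\<close>
  define ws where "ws = ys @ xs"
  have le: "w \<le> m" if "w \<in> set vs" for w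
    using that by (simp add: m_def)
  have ws: "2 \<le> length ws" "distinct ws" "m \<notin> set ws"
    using vs split by (auto simp: ws_def m_def[symmetric])
  have ne: "ws \<noteq> []"
    using ws(1) by auto
  have vs': "vs = xs @ m # ys"
    using split by (simp add: m_def)
  have adj: "successively (\<lambda>x y. (x, y) \<in> ?E) (last vs # xs @ m # ys)"
    using vs(3) vs' by simp
  have "(m, hd ws) \<in> ?E"
  proof (cases ys)
    case Nil
    then show ?thesis
      using adj ne vs' by (cases xs) (auto simp: ws_def)
  next
    case (Cons y ys')
    then show ?thesis
      using adj by (auto simp: ws_def successively_append_iff successively_Cons)
  qed
  moreover have "(last ws, m) \<in> ?E"
  proof (cases xs rule: rev_cases)
    case Nil
    then show ?thesis
      using adj ne vs' by (auto simp: ws_def)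
  next
    case (snoc xs' x)
    then show ?thesis
      using adj by (auto simp: ws_def successively_append_iff successively_Cons)
  qed
  moreover have "w < m" if "w \<in> set ws" for w
    using that ws(3) le[of w] vs' by (auto simp: ws_def order.strict_iff_order)
  then have "hd ws < m" "last ws < m"
    using ne by auto
  ultimately have "hd ws = par m" "last ws = par m"
    using par[of "hd ws"] par[of "last ws"] by (auto simp: parent_tree_def)
  moreover have "hd ws \<noteq> last ws"
    using ws(1,2) by (cases ws) auto
  ultimately show False
    by simp
qed

text \<open>Connectedness of the nodes containing \<open>v\<close> becomes a local check: there is a
  top node \<open>r\<close>, and every other such node has its parent among them.\<close>

lemma tree_decomposition_parent_tree:
  assumes "pair_graph G" "0 < k" and par: "\<And>i. 0 < i \<Longrightarrow> i < k \<Longrightarrow> par i < i"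
    and "\<And>i. i < k \<Longrightarrow> B i \<subseteq> pverts G"
    and root: "\<And>v. v \<in> pverts G \<Longrightarrow>
      \<exists>r<k. v \<in> B r \<and> (\<forall>i<k. v \<in> B i \<longrightarrow> i = r \<or> 0 < i \<and> v \<in> B (par i))"
    and "\<And>u v. (u, v) \<in> parcs G \<Longrightarrow> \<exists>i<k. u \<in> B i \<and> v \<in> B i"
  shows "tree_decomposition G (parent_tree k par) B"
proof -
  have pg: "pair_graph (parent_tree k par)"
    using par by (rule pair_graph_parent_tree)
  have verts: "pverts (parent_tree k par) = {..<k}"
    by (simp add: parent_tree_def)
  have "connected_on (parcs (parent_tree k par)) {..<k}"
    using par \<open>0 < k\<close> by (intro connected_on_parent_tree[of _ _ _ 0]) (auto intro: less_trans)
  then have "undirected_tree (parent_tree k par)"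
    using pg connected_pair_graph_iff[OF pg] cycle_free_iff[OF pg] cycle_free_parent_tree[OF par] verts
    by (simp add: undirected_tree_def)
  moreover have "connected_on (parcs (parent_tree k par)) {x \<in> {..<k}. v \<in> B x}" if v: "v \<in> pverts G" for v
  proof -
    obtain r where "r < k" "v \<in> B r" "\<forall>i<k. v \<in> B i \<longrightarrow> i = r \<or> 0 < i \<and> v \<in> B (par i)"
      using root[OF v] by blast
    then show ?thesis
      using par by (intro connected_on_parent_tree[of _ _ _ r]) (auto intro: less_trans)
  qed
  moreover have "\<forall>(u, v)\<in>parcs G. \<exists>x\<in>{..<k}. u \<in> B x \<and> v \<in> B x"
    using assms(6) by fast
  ultimately show ?thesis
    using assms(1,4) verts by (simp add: tree_decomposition_def connected_induce_subgraph_iff[OF pg])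
qed

section \<open>Treewidth bounds from bag sizes\<close>

lemma treewidth_le:
  fixes T :: "nat pair_pre_digraph"
  assumes "tree_decomposition G T B" "\<And>x. x \<in> pverts T \<Longrightarrow> card (B x) \<le> Suc w"
  shows "treewidth G \<le> w"
proof -
  have T: "pair_graph T" "pverts T \<noteq> {}"
    using assms(1) connected_pair_graph_iff[of T]
    by (auto simp: tree_decomposition_def undirected_tree_def connected_on_def)
  interpret T: pair_graph T by fact
  have "treewidth G \<le> width T B"
    unfolding treewidth_def using assms(1) by (intro Least_le) blast
  also have "Max ((\<lambda>x. card (B x)) ` pverts T) \<le> Suc w"
    using assms(2) T(2) T.pair_finite_verts by simp
  then have "width T B \<le> w"
    by (simp add: width_def)
  finally show ?thesis .
qed

text \<open>Applied to a decomposition of minimum width; the strict inequality makes up for the 1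
  subtracted in \<open>width\<close>.\<close>

lemma treewidth_ge:
  assumes "pair_graph G"
    and "\<And>(T :: nat pair_pre_digraph) B. tree_decomposition G T B \<Longrightarrow> \<exists>x\<in>pverts T. w < card (B x)"
  shows "w \<le> treewidth G"
proof -
  obtain T :: "nat pair_pre_digraph" and B where TB: "tree_decomposition G T B" "width T B = treewidth G"
    using treewidth_attained[OF assms(1)] by blast
  interpret T: pair_graph T
    using TB by (simp add: tree_decomposition_def undirected_tree_def)
  obtain x where x: "x \<in> pverts T" "w < card (B x)"
    using assms(2)[OF TB(1)] by blast
  then have "card (B x) \<le> Max ((\<lambda>x. card (B x)) ` pverts T)"
    using T.pair_finite_verts by simp
  then show ?thesis
    using x TB(2) unfolding width_def by linarith
qed

text \<open>By independence a vertex of \<open>I\<close> lies in its own leaf only, and all other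
  vertices lie in the centre. An edge with an end in \<open>I\<close> is covered by the leaf of that
  end, any other edge by the centre.\<close>

lemma treewidth_le_star:
  assumes G: "pair_graph G" and I: "I \<subseteq> pverts G" "\<And>u v. u \<in> I \<Longrightarrow> v \<in> I \<Longrightarrow> (u, v) \<notin> parcs G"
    and "card (pverts G - I) \<le> Suc w" "\<And>v. v \<in> I \<Longrightarrow> card {u. (v, u) \<in> parcs G} \<le> w"
  shows "treewidth G \<le> w"
proof -
  interpret G: pair_graph G by fact
  have fin: "finite I"
    using I G.pair_finite_verts finite_subset by blast
  \<comment> \<open>Numbering \<open>I\<close> from 1 leaves node \<open>0\<close> for the central
    bag.\<close>
  obtain f where f: "bij_betw f {1..card I} I"
    using ex_bij_betw_nat_finite_1[OF fin] by blast
  define B where "B i = (if i = 0 then pverts G - I else insert (f i) {u. (f i, u) \<in> parcs G})" for i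
  have sym: "(v, u) \<in> parcs G" if "(u, v) \<in> parcs G" for u v
    using G.sym_arcs that by (auto simp: symmetric_def dest: symD)
  have fI: "f i \<in> I" if "0 < i" "i < Suc (card I)" for i
    using f that by (auto simp: bij_betw_def)
  have surj: "\<exists>i. 0 < i \<and> i < Suc (card I) \<and> f i = v" if "v \<in> I" for v
  proof -
    have "v \<in> f ` {1..card I}"
      using f that by (simp add: bij_betw_def)
    then show ?thesis
      by (auto simp: Suc_le_eq less_Suc_eq_le)
  qed
  have inj: "i = j" if "0 < i" "i < Suc (card I)" "0 < j" "j < Suc (card I)" "f i = f j" for i j
    using that by (intro inj_onD[OF bij_betw_imp_inj_on[OF f]]) auto
  have td: "tree_decomposition G (parent_tree (Suc (card I)) (\<lambda>_. 0)) B"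
  proof (rule tree_decomposition_parent_tree[OF G])
    show "B i \<subseteq> pverts G" if "i < Suc (card I)" for i
      using that fI I by (auto simp: B_def dest: G.in_arcsD2)
    show "\<exists>r<Suc (card I). v \<in> B r \<and> (\<forall>i<Suc (card I). v \<in> B i \<longrightarrow> i = r \<or> 0 < i \<and> v \<in> B 0)"
      if "v \<in> pverts G" for v
    proof (cases "v \<in> I")
      case True
      then obtain r where r: "0 < r" "r < Suc (card I)" "f r = v"
        using surj by blast
      have "i = r" if i: "i < Suc (card I)" "v \<in> B i" for i
      proof -
        have "0 < i"
          using i(2) True by (cases i) (auto simp: B_def)
        then have "f i = v"
          using i(2) I(2)[OF fI[OF _ i(1)] True] by (simp add: B_def)
        then show ?thesis
          using inj[OF \<open>0 < i\<close> i(1) r(1,2)] r(3) by simp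
      qed
      moreover have "v \<in> B r"
        using r by (simp add: B_def)
      ultimately show ?thesis
        using r(2) by blast
    next
      case False
      then have "v \<in> B 0"
        using that by (simp add: B_def)
      then show ?thesis
        by (metis zero_less_Suc gr0I)
    qed
    show "\<exists>i<Suc (card I). u \<in> B i \<and> v \<in> B i" if uv: "(u, v) \<in> parcs G" for u v
    proof (cases "u \<in> I \<or> v \<in> I")
      case True
      then obtain a b where ab: "a \<in> I" "(a, b) \<in> parcs G" "{u, v} = {a, b}"
        using uv sym[OF uv] by blast
      obtain i where "0 < i" "i < Suc (card I)" "f i = a"
        using surj[OF ab(1)] by blast
      then have "i < Suc (card I)" "{a, b} \<subseteq> B i"
        using ab(2) by (auto simp: B_def)
      then show ?thesis
        unfolding ab(3)[symmetric] by blast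
    next
      case False
      then have "u \<in> B 0" "v \<in> B 0"
        using uv by (auto simp: B_def dest: G.in_arcsD1 G.in_arcsD2)
      then show ?thesis
        by blast
    qed
  qed auto
  have "card (B i) \<le> Suc w" if "i < Suc (card I)" for i
    using that assms(4,5) fI[of i] card_insert_le_m1[of "Suc w" "{u. (f i, u) \<in> parcs G}" "f i"]
    by (cases "i = 0") (auto simp: B_def)
  then show ?thesis
    by (intro treewidth_le[OF td]) (auto simp: parent_tree_def)
qed

section \<open>Intersecting families of pairs\<close>

definition pairs :: "nat \<Rightarrow> nat set set" where
  "pairs n = {A. A \<subseteq> {1..n} \<and> card A = 2}"

lemma finite_pairs: "finite (pairs n)"
  by (rule finite_subset[of _ "Pow {1..n}"]) (auto simp: pairs_def)

lemma card_pairs: "card (pairs n) = n choose 2"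
  by (simp add: pairs_def n_subsets)

lemma pverts_Kneser: "pverts (Kneser n 2) = pairs n"
  by (simp add: Kneser_def pairs_def)

lemma parcs_Kneser: "(a, b) \<in> parcs (Kneser n 2) \<longleftrightarrow> a \<in> pairs n \<and> b \<in> pairs n \<and> a \<inter> b = {}"
  by (auto simp: Kneser_def pairs_def)

lemma card_star_le:
  assumes "H \<subseteq> pairs n" "\<And>A. A \<in> H \<Longrightarrow> x \<in> A" "1 \<le> n"
  shows "card H \<le> n - 1"
proof (cases "H = {}")
  case False
  then have x: "x \<in> {1..n}"
    using assms(1,2) unfolding pairs_def by blast
  have "H \<subseteq> (\<lambda>y. {x, y}) ` ({1..n} - {x})"
  proof
    fix A assume "A \<in> H"
    then have "card A = 2" "x \<in> A" "A \<subseteq> {1..n}"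
      using assms by (auto simp: pairs_def)
    then show "A \<in> (\<lambda>y. {x, y}) ` ({1..n} - {x})"
      by (auto simp: card_2_iff)
  qed
  then have "card H \<le> card ((\<lambda>y. {x, y}) ` ({1..n} - {x}))"
    by (rule card_mono[rotated]) simp
  also have "\<dots> \<le> card ({1..n} - {x})"
    by (rule card_image_le) simp
  also have "\<dots> = n - 1"
    using x by simp
  finally show ?thesis .
qed simp

text \<open>Pairwise meeting edges form a star or a triangle. Without a common vertex, an edge
  avoiding \<open>b\<close> and one avoiding \<open>a\<close> complete \<open>A\<close> to a
  triangle, and a pair meeting all three sides is one of them.\<close>

lemma card_pairwise_intersecting_le:
  assumes H: "H \<subseteq> pairs n" "\<And>A B. A \<in> H \<Longrightarrow> B \<in> H \<Longrightarrow> A \<inter> B \<noteq> {}" and "1 \<le> n"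
  shows "card H \<le> max 3 (n - 1)"
proof (cases "\<exists>x. \<forall>A\<in>H. x \<in> A")
  case True
  then obtain x where "\<And>A. A \<in> H \<Longrightarrow> x \<in> A"
    by blast
  then have "card H \<le> n - 1"
    using card_star_le[OF H(1) _ assms(3)] by blast
  then show ?thesis
    by simp
next
  case False
  have two: "\<exists>x y. A = {x, y} \<and> x \<noteq> y" if "A \<in> H" for A
    using that H(1) by (auto simp: pairs_def card_2_iff)
  obtain A where A: "A \<in> H"
    using False by blast
  then obtain a b where ab: "A = {a, b}" "a \<noteq> b"
    using two by blast
  obtain B where B: "B \<in> H" "b \<notin> B"
    using False by blast
  then obtain c where c: "B = {a, c}" "a \<noteq> c"
    using two[OF B(1)] H(2)[OF A B(1)] ab by (auto simp: doubleton_eq_iff)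
  obtain C where C: "C \<in> H" "a \<notin> C"
    using False by blast
  then have C': "C = {b, c}"
    using two[OF C(1)] H(2)[OF A C(1)] H(2)[OF B(1) C(1)] ab c B by auto
  have "D \<in> {{a, b}, {a, c}, {b, c}}" if D: "D \<in> H" for D
    using two[OF D] H(2)[OF A D] H(2)[OF B(1) D] H(2)[OF C(1) D] ab c C' B(2) by auto
  then have "H \<subseteq> {{a, b}, {a, c}, {b, c}}"
    by blast
  then have "card H \<le> card {{a, b}, {a, c}, {b, c}}"
    by (rule card_mono[rotated]) simp
  also have "\<dots> \<le> 3"
    by (simp add: card_insert_if)
  finally show ?thesis
    by simp
qed

section \<open>The lower bound\<close>

text \<open>A non-isolated vertex of the graph induced by \<open>H\<close>. Fixing it by choice
  makes the component a function of \<open>H\<close>, so equal families have equal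
  components.\<close>

definition hub :: "nat set set \<Rightarrow> nat set" where
  "hub H = (SOME a. a \<in> H \<and> (\<exists>b\<in>H. a \<inter> b = {}))"

definition hub_component :: "nat \<Rightarrow> nat set set \<Rightarrow> nat set set" where
  "hub_component n H = {v. (hub H, v) \<in> rtrancl_on H (parcs (Kneser n 2))}"

lemma hub_component_subset: "hub_component n H \<subseteq> H"
  by (auto simp: hub_component_def dest: in_rtrancl_on_in_F)

lemma sym_Kneser: "sym (parcs (Kneser n 2))"
  by (rule symI) (auto simp: parcs_Kneser)

lemma hub_component_closed:
  assumes "H \<subseteq> pairs n" "v \<in> hub_component n H" "w \<in> H" "v \<inter> w = {}"
  shows "w \<in> hub_component n H"
proof -
  have "(hub H, v) \<in> rtrancl_on H (parcs (Kneser n 2))" "v \<in> H"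
    using assms(2) hub_component_subset by (auto simp: hub_component_def)
  moreover from this have "(v, w) \<in> parcs (Kneser n 2)"
    using assms by (auto simp: parcs_Kneser)
  ultimately show ?thesis
    using rtrancl_on_into_rtrancl_on[OF _ _ assms(3)] by (auto simp: hub_component_def)
qed

text \<open>An intersecting family has at most \<open>max 3 (n - 1)\<close> members, fewer than
  \<open>H\<close>, so \<open>H\<close> contains two disjoint edges and the choice in
  \<open>hub\<close> succeeds.\<close>

lemma hub_component:
  assumes "H \<subseteq> pairs n" "6 \<le> card H" "n \<le> card H" "1 \<le> n"
  shows "\<exists>b\<in>hub_component n H. hub H \<inter> b = {}" "hub H \<in> hub_component n H"
    and "connected_on (parcs (Kneser n 2)) (hub_component n H)"
proof -
  let ?E = "parcs (Kneser n 2)" and ?C = "hub_component n H"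
  have "\<exists>a\<in>H. \<exists>b\<in>H. a \<inter> b = {}"
    using card_pairwise_intersecting_le[OF assms(1) _ assms(4)] assms by fastforce
  then have hub: "hub H \<in> H" "\<exists>b\<in>H. hub H \<inter> b = {}"
    unfolding hub_def by (metis (mono_tags, lifting) someI_ex)+
  then show h: "hub H \<in> ?C"
    by (simp add: hub_component_def)
  then show "\<exists>b\<in>?C. hub H \<inter> b = {}"
    using hub hub_component_closed[OF assms(1)] by blast
  have "(hub H, v) \<in> rtrancl_on ?C ?E" if "(hub H, v) \<in> rtrancl_on H ?E" for v
    using that
  proof (induction rule: rtrancl_on_induct)
    case base
    then show ?case using h by simp
  next
    case (step y z)
    then have "z \<in> ?C"
      unfolding hub_component_def using rtrancl_on_into_rtrancl_on[OF step(1,2,4)] by simp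
    then show ?case
      using rtrancl_on_into_rtrancl_on[OF step(5,2)] by simp
  qed
  then show "connected_on ?E ?C"
    by (intro connected_onI_root[OF sym_Kneser h]) (simp add: hub_component_def)
qed

text \<open>The disjoint sets \<open>a\<close> and \<open>b\<close> meet \<open>w\<close> in
  different elements, and \<open>w\<close> has only two.\<close>

lemma pair_subset_Un:
  assumes "card w = 2" "w \<inter> a \<noteq> {}" "w \<inter> b \<noteq> {}" "a \<inter> b = {}"
  shows "w \<subseteq> a \<union> b"
proof -
  obtain x y where "w = {x, y}"
    using assms(1) by (auto simp: card_2_iff)
  then show ?thesis
    using assms(2-4) by auto
qed

text \<open>
  Two components that do not touch consist of edges of the same \<open>K\<^sub>4\<close>. An edge of \<open>H\<close> outside its
  component meets all edges of that component, so both \<open>H\<close> and \<open>H'\<close> lie in that \<open>K\<^sub>4\<close>, and having six edges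
  they are equal to it.
\<close>

lemma hub_component_touch:
  assumes H: "H \<subseteq> pairs n" "6 \<le> card H" "n \<le> card H"
    and H': "H' \<subseteq> pairs n" "6 \<le> card H'" "n \<le> card H'" and "1 \<le> n"
  shows "\<exists>u\<in>hub_component n H. \<exists>v\<in>hub_component n H'. u = v \<or> u \<inter> v = {}"
proof (rule ccontr)
  let ?C = "hub_component n H" and ?C' = "hub_component n H'"
  assume no: "\<not> ?thesis"
  then have cross: "u \<inter> v \<noteq> {}" if "u \<in> ?C" "v \<in> ?C'" for u v
    using that by blast
  obtain a b where ab: "a \<in> ?C" "b \<in> ?C" "a \<inter> b = {}"
    using hub_component[OF H assms(7)] by blast
  obtain c d where cd: "c \<in> ?C'" "d \<in> ?C'" "c \<inter> d = {}"
    using hub_component[OF H' assms(7)] by blast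
  have card2: "card w = 2" "finite w" if "w \<in> H \<or> w \<in> H'" for w
    using that H(1) H'(1) by (auto simp: pairs_def intro: finite_subset)
  note sub = hub_component_subset[THEN subsetD]
  have abcd: "a \<in> H" "b \<in> H" "c \<in> H'" "d \<in> H'"
    using ab cd sub by auto
  \<comment> \<open>Each of \<open>c\<close>, \<open>d\<close> meets both of the disjoint edges
    \<open>a\<close>, \<open>b\<close>, and conversely, so the two unions coincide.\<close>
  have "c \<subseteq> a \<union> b" "d \<subseteq> a \<union> b"
    using cross[OF ab(1) cd(1)] cross[OF ab(1) cd(2)] cross[OF ab(2) cd(1)] cross[OF ab(2) cd(2)]
      card2(1) abcd ab(3) by (simp_all add: pair_subset_Un Int_commute)
  moreover have "a \<subseteq> c \<union> d" "b \<subseteq> c \<union> d"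
    using cross[OF ab(1) cd(1)] cross[OF ab(1) cd(2)] cross[OF ab(2) cd(1)] cross[OF ab(2) cd(2)]
      card2(1) abcd cd(3) by (simp_all add: pair_subset_Un)
  ultimately have K: "a \<union> b = c \<union> d"
    by blast
  have "card (a \<union> b) = 4"
    using card_Un_disjoint[of a b] card2[of a] card2[of b] abcd ab(3) by simp
  then have six: "card {w. w \<subseteq> a \<union> b \<and> card w = 2} = 6" "finite (a \<union> b)"
    using n_subsets[of "a \<union> b" 2] card2[of a] card2[of b] abcd by (auto simp: numeral_eq_Suc)
  have "w \<subseteq> a \<union> b" if "w \<in> H" for w
  proof (cases "w \<in> ?C")
    case True
    then show ?thesis
      using pair_subset_Un[of w c d] card2(1)[of w] that cross[OF True] cd K by auto
  next
    case False
    then have "a \<inter> w \<noteq> {}" "b \<inter> w \<noteq> {}"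
      using hub_component_closed[OF H(1) _ that] ab by blast+
    then show ?thesis
      using pair_subset_Un[of w a b] card2(1)[of w] that ab by (auto simp: Int_commute)
  qed
  then have "H = {w. w \<subseteq> a \<union> b \<and> card w = 2}"
    using six H(2) card2(1) by (intro card_seteq) auto
  moreover have "w \<subseteq> a \<union> b" if "w \<in> H'" for w
  proof (cases "w \<in> ?C'")
    case True
    then show ?thesis
      using pair_subset_Un[of w a b] card2(1)[of w] that cross[OF _ True] ab
      by (auto simp: Int_commute)
  next
    case False
    then have "c \<inter> w \<noteq> {}" "d \<inter> w \<noteq> {}"
      using hub_component_closed[OF H'(1) _ that] cd by blast+
    then show ?thesis
      using pair_subset_Un[of w c d] card2(1)[of w] that cd K by (auto simp: Int_commute)
  qed
  then have "H' = {w. w \<subseteq> a \<union> b \<and> card w = 2}"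
    using six H'(2) card2(1) by (intro card_seteq) auto
  ultimately have "H = H'"
    by simp
  \<comment> \<open>Now both components are the same, and the shared vertex \<open>a\<close> already
    counts as touching.\<close>
  then show False
    using no ab(1) by blast
qed

lemma treewidth_Kneser_ge:
  assumes "1 \<le> n" "w + max 6 n \<le> n choose 2"
  shows "w \<le> treewidth (Kneser n 2)"
proof (rule treewidth_ge[OF pair_graph_Kneser])
  fix T :: "nat pair_pre_digraph" and B
  assume td: "tree_decomposition (Kneser n 2) T B"
  show "\<exists>x\<in>pverts T. w < card (B x)"
  proof (rule ccontr)
    assume "\<not> ?thesis"
    then have small: "card (B x) \<le> w" "B x \<subseteq> pairs n" if "x \<in> pverts T" for x
      using that td by (auto simp: tree_decomposition_def pverts_Kneser not_less)
    \<comment> \<open>The bramble is built from all families of this size; under the assumption the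
      complements of the bags are among them.\<close>
    define F where "F = {H. H \<subseteq> pairs n \<and> 6 \<le> card H \<and> n \<le> card H}"
    have "\<exists>x\<in>pverts T. \<forall>S\<in>hub_component n ` F. B x \<inter> S \<noteq> {}"
    proof (rule bramble_hit_by_bag[OF td])
      show "S \<subseteq> pverts (Kneser n 2) \<and> connected_on (parcs (Kneser n 2)) S"
        if S: "S \<in> hub_component n ` F" for S
      proof -
        obtain H where H: "H \<in> F" "S = hub_component n H"
          using S by blast
        then show ?thesis
          using hub_component(3)[OF _ _ _ assms(1), of H] hub_component_subset[of n H]
          by (auto simp: F_def pverts_Kneser)
      qed
      show "S \<inter> S' \<noteq> {} \<or> (\<exists>u\<in>S. \<exists>v\<in>S'. (u, v) \<in> parcs (Kneser n 2))"
        if S: "S \<in> hub_component n ` F" "S' \<in> hub_component n ` F" for S S'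
      proof -
        obtain H H' where HH: "H \<in> F" "H' \<in> F" "S = hub_component n H" "S' = hub_component n H'"
          using S by blast
        then obtain u v where uv: "u \<in> S" "v \<in> S'" "u = v \<or> u \<inter> v = {}"
          using hub_component_touch[of H n H'] assms(1) by (auto simp: F_def)
        then have "u \<in> pairs n" "v \<in> pairs n"
          using HH hub_component_subset[of n H] hub_component_subset[of n H'] unfolding F_def by blast+
        then show ?thesis
          using uv by (auto simp: parcs_Kneser)
      qed
    qed
    then obtain x where x: "x \<in> pverts T" "\<forall>S\<in>hub_component n ` F. B x \<inter> S \<noteq> {}"
      by (elim bexE)
    have "card (pairs n - B x) = (n choose 2) - card (B x)"
      using small(2)[OF x(1)] finite_pairs by (simp add: card_Diff_subset card_pairs finite_subset)
    then have "pairs n - B x \<in> F"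
      using small(1)[OF x(1)] assms(2) by (auto simp: F_def)
    then have "B x \<inter> hub_component n (pairs n - B x) \<noteq> {}"
      using x(2) by simp
    then show False
      using hub_component_subset[of n "pairs n - B x"] by blast
  qed
qed simp

section \<open>The upper bounds\<close>

lemma pairs_cases:
  assumes "A \<in> pairs n"
  obtains a b where "1 \<le> a" "a < b" "b \<le> n" "A = {a, b}"
proof -
  obtain x y where "A = {x, y}" "x \<noteq> y" "{x, y} \<subseteq> {1..n}"
    using assms by (auto simp: pairs_def card_2_iff)
  then show thesis
    using that[of x y] that[of y x] by (cases "x < y") (auto simp: insert_commute)
qed

text \<open>The independent set consists of the pairs containing \<open>n\<close>; the central bag
  is then \<open>pairs (n - 1)\<close>. The bound is too weak for \<open>n = 4\<close> and
  \<open>n = 5\<close>, where it gives 2 and 5.\<close>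

lemma treewidth_Kneser_le_star:
  assumes "4 \<le> n"
  shows "treewidth (Kneser n 2) \<le> (n - 1 choose 2) - 1"
proof (rule treewidth_le_star[OF pair_graph_Kneser, of 2 "{A \<in> pairs n. n \<in> A}"])
  obtain m where m: "n = Suc m" "3 \<le> m"
    using assms by (cases n) auto
  have "{A \<in> pairs n. n \<notin> A} = pairs m"
    using m by (auto simp: pairs_def subset_iff le_Suc_eq)
  moreover have "pverts (Kneser n 2) - {A \<in> pairs n. n \<in> A} = {A \<in> pairs n. n \<notin> A}"
    by (auto simp: pverts_Kneser)
  ultimately show "card (pverts (Kneser n 2) - {A \<in> pairs n. n \<in> A}) \<le> Suc ((n - 1 choose 2) - 1)"
    using m by (simp add: card_pairs)
  show "card {B. (A, B) \<in> parcs (Kneser n 2)} \<le> (n - 1 choose 2) - 1" if A: "A \<in> {A \<in> pairs n. n \<in> A}" for A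
  proof -
    have AA: "card A = 2" "A \<subseteq> {1..n}"
      using A by (auto simp: pairs_def)
    have "{B. (A, B) \<in> parcs (Kneser n 2)} = {B. B \<subseteq> {1..n} - A \<and> card B = 2}"
      using A by (auto simp: parcs_Kneser pairs_def)
    then have "card {B. (A, B) \<in> parcs (Kneser n 2)} = card ({1..n} - A) choose 2"
      by (simp add: n_subsets)
    also have "card ({1..n} - A) = m - 1"
      using AA m by (simp add: card_Diff_subset finite_subset)
    \<comment> \<open>By Pascal's rule the two binomials differ by \<open>m - 1\<close>, which is
      positive.\<close>
    also have "m - 1 choose 2 \<le> (m choose 2) - 1"
      using m by (cases m) (auto simp: numeral_2_eq_2)
    finally show ?thesis
      using m by simp
  qed
qed (auto simp: pverts_Kneser parcs_Kneser)

text \<open>Two disjoint pairs need four points, so there are no edges and all vertices may form the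
  independent set: the centre is empty and the leaves are singletons.\<close>

lemma treewidth_Kneser_le_3:
  assumes "n \<le> 3"
  shows "treewidth (Kneser n 2) = 0"
proof -
  have "(a, b) \<notin> parcs (Kneser n 2)" for a b
  proof
    assume "(a, b) \<in> parcs (Kneser n 2)"
    then have ab: "a \<in> pairs n" "b \<in> pairs n" "a \<inter> b = {}"
      by (auto simp: parcs_Kneser)
    then have "card (a \<union> b) = 4"
      by (subst card_Un_disjoint) (auto simp: pairs_def intro: finite_subset)
    moreover have "card (a \<union> b) \<le> card {1..n}"
      using ab by (intro card_mono) (auto simp: pairs_def)
    ultimately show False
      using assms by simp
  qed
  then have "treewidth (Kneser n 2) \<le> 0"
    by (intro treewidth_le_star[OF pair_graph_Kneser, of 2 "pairs n"]) (simp_all add: pverts_Kneser)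
  then show ?thesis
    by simp
qed

section \<open>The exceptional cases \<open>n = 4\<close> and \<open>n = 5\<close>\<close>

lemma pairs_4: "pairs 4 = {{1,2},{1,3},{1,4},{2,3},{2,4},{3,4}}"
proof
  show "pairs 4 \<subseteq> {{1,2},{1,3},{1,4},{2,3},{2,4},{3,4}}"
  proof
    fix A assume "A \<in> pairs 4"
    then obtain a b where ab: "1 \<le> a" "a < b" "b \<le> 4" "A = {a, b}"
      by (rule pairs_cases)
    then have "a = 1 \<or> a = 2 \<or> a = 3" "b = 2 \<or> b = 3 \<or> b = 4"
      by linarith+
    then show "A \<in> {{1,2},{1,3},{1,4},{2,3},{2,4},{3,4}}"
      using ab(2,4) by (elim disjE) simp_all
  qed
qed (auto simp: pairs_def)

lemma pairs_5: "pairs 5 = {{1,2},{1,3},{1,4},{1,5},{2,3},{2,4},{2,5},{3,4},{3,5},{4,5}}"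
proof
  show "pairs 5 \<subseteq> {{1,2},{1,3},{1,4},{1,5},{2,3},{2,4},{2,5},{3,4},{3,5},{4,5}}"
  proof
    fix A assume "A \<in> pairs 5"
    then obtain a b where ab: "1 \<le> a" "a < b" "b \<le> 5" "A = {a, b}"
      by (rule pairs_cases)
    then have "a = 1 \<or> a = 2 \<or> a = 3 \<or> a = 4" "b = 2 \<or> b = 3 \<or> b = 4 \<or> b = 5"
      by linarith+
    then show "A \<in> {{1,2},{1,3},{1,4},{1,5},{2,3},{2,4},{2,5},{3,4},{3,5},{4,5}}"
      using ab(2,4) by (elim disjE) simp_all
  qed
qed (auto simp: pairs_def)

text \<open>The graph consists of three disjoint edges. One bag per edge suffices, joined through an
  empty bag at the root; conversely an edge needs a bag with two elements.\<close>

lemma treewidth_Kneser_4: "treewidth (Kneser 4 2) = 1"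
proof (rule antisym)
  define B where "B i = (if i = 0 then {} else if i = 1 then {{1,2},{3,4}}
    else if i = 2 then {{1,3},{2,4}} else {{1,4},{2,3::nat}})" for i :: nat
  \<comment> \<open>Unrolling the bounded quantifiers leaves finitely many cases for the
    simplifier.\<close>
  have ex: "(\<exists>i<4. P i) \<longleftrightarrow> P 0 \<or> P 1 \<or> P 2 \<or> P 3" for P :: "nat \<Rightarrow> bool"
    by (auto simp: numeral_eq_Suc Ex_less_Suc)
  have all: "(\<forall>i<4. P i) \<longleftrightarrow> P 0 \<and> P 1 \<and> P 2 \<and> P 3" for P :: "nat \<Rightarrow> bool"
    by (auto simp: numeral_eq_Suc All_less_Suc)
  have td: "tree_decomposition (Kneser 4 2) (parent_tree 4 (\<lambda>_. 0)) B"
  proof (rule tree_decomposition_parent_tree[OF pair_graph_Kneser])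
    show "B i \<subseteq> pverts (Kneser 4 2)" for i
      by (auto simp: B_def pverts_Kneser pairs_4)
    show "\<exists>r<4. v \<in> B r \<and> (\<forall>i<4. v \<in> B i \<longrightarrow> i = r \<or> 0 < i \<and> v \<in> B 0)"
      if "v \<in> pverts (Kneser 4 2)" for v
      using that unfolding ex all pverts_Kneser pairs_4 insert_iff empty_iff
      by (elim disjE) (simp_all add: B_def doubleton_eq_iff)
    show "\<exists>i<4. u \<in> B i \<and> v \<in> B i" if "(u, v) \<in> parcs (Kneser 4 2)" for u v
      using that unfolding ex parcs_Kneser pairs_4 insert_iff empty_iff
      by (elim conjE disjE) (simp_all add: B_def doubleton_eq_iff)
  qed auto
  show "treewidth (Kneser 4 2) \<le> 1"
    by (rule treewidth_le[OF td]) (simp add: B_def card_insert_if)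
  show "1 \<le> treewidth (Kneser 4 2)"
  proof (rule treewidth_ge[OF pair_graph_Kneser])
    fix T :: "nat pair_pre_digraph" and B
    assume T: "tree_decomposition (Kneser 4 2) T B"
    have "({1,2},{3,4}) \<in> parcs (Kneser 4 2)"
      by (simp add: parcs_Kneser pairs_4)
    then obtain x where x: "x \<in> pverts T" "{{1,2},{3,4}} \<subseteq> B x"
      using T by (auto simp: tree_decomposition_def)
    moreover have "finite (B x)"
      using T x(1) by (auto simp: tree_decomposition_def pverts_Kneser intro: finite_subset[OF _ finite_pairs])
    ultimately have "card {{1,2},{3,4::nat}} \<le> card (B x)"
      by (intro card_mono)
    then show "\<exists>x\<in>pverts T. 1 < card (B x)"
      using x(1) by (intro bexI[of _ x]) (simp_all add: doubleton_eq_iff card_insert_if)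
  qed simp
qed

text \<open>This is the Petersen graph. Bags 0, 1, 2 hold the four pairs containing 5 together with
  one of \<open>{3,4}\<close>, \<open>{2,4}\<close>, \<open>{2,3}\<close>. Bags 3, 4, 5 are the
  closed neighbourhoods of \<open>{1,2}\<close>, \<open>{1,3}\<close>, \<open>{1,4}\<close>.\<close>

lemma treewidth_Kneser_5_le: "treewidth (Kneser 5 2) \<le> 4"
proof -
  define B where "B i = (
    if i = 0 then {{1,5},{2,5},{3,5},{4,5},{3,4}}
    else if i = 1 then {{1,5},{2,5},{3,5},{4,5},{2,4}}
    else if i = 2 then {{1,5},{2,5},{3,5},{4,5},{2,3}}
    else if i = 3 then {{1,2},{3,4},{3,5},{4,5}}
    else if i = 4 then {{1,3},{2,4},{2,5},{4,5}}
    else {{1,4},{2,3},{2,5},{3,5::nat}})" for i :: nat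
  \<comment> \<open>Nodes 1 and 2 hang at 0, and each leaf 3, 4, 5 hangs at the node smaller by 3,
    which holds the disjoint partner of its centre.\<close>
  define par where "par i = (if i \<le> 3 then 0 else i - 3)" for i :: nat
  have ex: "(\<exists>i<6. P i) \<longleftrightarrow> P 0 \<or> P 1 \<or> P 2 \<or> P 3 \<or> P 4 \<or> P 5" for P :: "nat \<Rightarrow> bool"
    by (auto simp: numeral_eq_Suc Ex_less_Suc)
  have all: "(\<forall>i<6. P i) \<longleftrightarrow> P 0 \<and> P 1 \<and> P 2 \<and> P 3 \<and> P 4 \<and> P 5" for P :: "nat \<Rightarrow> bool"
    by (auto simp: numeral_eq_Suc All_less_Suc)
  have td: "tree_decomposition (Kneser 5 2) (parent_tree 6 par) B"
  proof (rule tree_decomposition_parent_tree[OF pair_graph_Kneser])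
    show "B i \<subseteq> pverts (Kneser 5 2)" for i
      by (simp add: B_def pverts_Kneser pairs_5)
    show "\<exists>r<6. v \<in> B r \<and> (\<forall>i<6. v \<in> B i \<longrightarrow> i = r \<or> 0 < i \<and> v \<in> B (par i))"
      if "v \<in> pverts (Kneser 5 2)" for v
      using that unfolding ex all pverts_Kneser pairs_5 insert_iff empty_iff
      by (elim disjE) (simp_all add: B_def par_def doubleton_eq_iff)
    show "\<exists>i<6. u \<in> B i \<and> v \<in> B i" if "(u, v) \<in> parcs (Kneser 5 2)" for u v
      using that unfolding ex parcs_Kneser pairs_5 insert_iff empty_iff
      by (elim conjE disjE) (simp_all add: B_def doubleton_eq_iff)
  qed (auto simp: par_def)
  show ?thesis
    by (rule treewidth_le[OF td]) (simp add: B_def doubleton_eq_iff)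
qed

theorem theorem2:
  fixes n :: nat
  assumes "n \<ge> 1"
  shows "treewidth (Kneser n 2) =
    (if n \<le> 3 then 0
     else if n = 4 then 1
     else if n = 5 then 4
     else (n - 1 choose 2) - 1)"
proof -
  consider "n \<le> 3" | "n = 4" | "n = 5" | "6 \<le> n"
    by linarith
  then show ?thesis
  proof cases
    case 3
    \<comment> \<open>The bound is tight: \<open>4 + max 6 5\<close> equals the number 10 of
      vertices.\<close>
    have "4 \<le> treewidth (Kneser 5 2)"
      by (rule treewidth_Kneser_ge) (simp_all add: choose_two)
    then show ?thesis
      using 3 treewidth_Kneser_5_le by simp
  next
    case 4
    then obtain m where m: "n = Suc m" "5 \<le> m"
      by (cases n) auto
    \<comment> \<open>This makes the truncated subtraction of 1 a genuine one.\<close>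
    have "1 \<le> m choose 2"
      using m zero_less_binomial[of 2 m] by linarith
    \<comment> \<open>Both sides are equal: here \<open>max 6 n\<close> is \<open>m + 1\<close>, and
      by Pascal's rule \<open>n choose 2\<close> is \<open>(m choose 2) + m\<close>.\<close>
    then have "(n - 1 choose 2) - 1 + max 6 n \<le> n choose 2"
      using m by (simp add: numeral_2_eq_2)
    then have "(n - 1 choose 2) - 1 \<le> treewidth (Kneser n 2)"
      using assms by (intro treewidth_Kneser_ge)
    then show ?thesis
      using 4 treewidth_Kneser_le_star[of n] by simp
  qed (simp_all add: treewidth_Kneser_le_3 treewidth_Kneser_4)
qed

end
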